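(* Let $m\ge 1$ be an integer and let $(x_k)_{k\ge 0}$ be generated by Anderson acceleration AA($m$) from an initial guess $x_0\in\mathbb{R}^n$, applied to the linear fixed-point function $q(x)=Mx+b$, with residuals $r_k=x_k-q(x_k)$. Assume that $M$ is invertible. Then for all $k\ge m$, $$ R_k^T M^{-1} r_{k+1}=0, $$ where $R_k=[\,r_k-r_{k-1}\ \ r_k-r_{k-2}\ \cdots\ r_k-r_{k-m}\,]$.
   Context: Setting: $M\in\mathbb{R}^{n\times n}$, $b\in\mathbb{R}^n$, $q(x)=Mx+b$, $A=I-M$ is nonsingular and $M\neq 0$. $\|\cdot\|$ is the 2-norm. The residual is $r(x)=x-q(x)=Ax-b$ and $r_k=r(x_k)$. AA($m$) with finite window size $m$: given $x_0\in\mathbb{R}^n$, for $k=0,1,2,\ldots$, with $m_k=\min(k,m)$, $$x_{k+1}=q(x_k)+\sum_{i=1}^{m_k}\beta_i^{(k)}\big(q(x_k)-q(x_{k-i})\big)$$ (so $x_1=q(x_0)$). The coefficient vector $\boldsymbol\beta^{(k)}=(\beta_1^{(k)},\ldots,\beta_{m_k}^{(k)})^T$ is the minimum-norm minimizer of $\|r_k+\sum_{i=1}^{m_k}\beta_i(r_k-r_{k-i})\|^2$, i.e. $\boldsymbol\beta^{(k)}=-R_k^{\dagger}r_k$ with $R_k=[\,r_k-r_{k-1}\ \cdots\ r_k-r_{k-m_k}\,]$ and $\dagger$ the pseudo-inverse; it equals $-(R_k^TR_k)^{-1}R_k^Tr_k$ if $R_k^TR_k$ is invertible. *)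

theory Defs
  imports Complex_Main "Jordan_Normal_Form.Gauss_Jordan_Elimination"
begin

definition norm2 :: "real vec \<Rightarrow> real" where
  "norm2 v = sqrt (v \<bullet> v)"

definition fp_map :: "real mat \<Rightarrow> real vec \<Rightarrow> real vec \<Rightarrow> real vec" where
  "fp_map M b x = M *\<^sub>v x + b"

definition residual :: "real mat \<Rightarrow> real vec \<Rightarrow> real vec \<Rightarrow> real vec" where
  "residual M b x = x - fp_map M b x"

(* The n x p matrix [v_k - v_{k-1}, ..., v_k - v_{k-p}] (used with p \<le> k, so that the
   subtraction on indices does not truncate).  JNF matrices are indexed from 0, so the
   1-based column i of the text is column i - 1 here. *)
definition diff_mat :: "nat \<Rightarrow> (nat \<Rightarrow> real vec) \<Rightarrow> nat \<Rightarrow> nat \<Rightarrow> real mat" where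
  "diff_mat n v k p = mat_of_cols n (map (\<lambda>i. v k - v (k - i)) [1..<p+1])"

(* diff_mat n v k p *\<^sub>v \<beta> is the vector sum \<Sum>i=1..p. \<beta>_i (v_k - v_{k-i}); it is the
   zero vector when p = 0. *)
lemma diff_mat_mult_vec:
  assumes "\<And>j. v j \<in> carrier_vec n" and "\<beta> \<in> carrier_vec p" and "l < n"
  shows "(diff_mat n v k p *\<^sub>v \<beta>) $ l = (\<Sum>i=1..p. \<beta> $ (i - 1) * (v k $ l - v (k - i) $ l))"
proof -
  have dim: "dim_vec (v j) = n" for j using assms(1)[of j] by auto
  have "(diff_mat n v k p *\<^sub>v \<beta>) $ l
      = (\<Sum>i=0..<p. \<beta> $ i * (v k $ l - v (k - Suc i) $ l))"
    using assms(2,3) dim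
    by (auto simp: diff_mat_def scalar_prod_def mat_of_cols_def nth_append mult.commute
             simp del: upt_Suc intro!: sum.cong)
  also have "\<dots> = (\<Sum>i=1..p. \<beta> $ (i - 1) * (v k $ l - v (k - i) $ l))"
    by (rule sum.reindex_bij_witness[of _ "\<lambda>i. i - 1" Suc]) auto
  finally show ?thesis .
qed

definition is_minimizer :: "nat \<Rightarrow> (real vec \<Rightarrow> real) \<Rightarrow> real vec \<Rightarrow> bool" where
  "is_minimizer p f \<beta> \<longleftrightarrow> \<beta> \<in> carrier_vec p \<and> (\<forall>\<gamma> \<in> carrier_vec p. f \<beta> \<le> f \<gamma>)"

definition is_min_norm_minimizer :: "nat \<Rightarrow> (real vec \<Rightarrow> real) \<Rightarrow> real vec \<Rightarrow> bool" where
  "is_min_norm_minimizer p f \<beta> \<longleftrightarrow>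
     is_minimizer p f \<beta> \<and> (\<forall>\<gamma>. is_minimizer p f \<gamma> \<longrightarrow> norm2 \<beta> \<le> norm2 \<gamma>)"

(* x is the sequence generated by AA(m) for q(x) = M x + b in R^n from the initial guess x 0. *)
definition anderson :: "nat \<Rightarrow> nat \<Rightarrow> real mat \<Rightarrow> real vec \<Rightarrow> (nat \<Rightarrow> real vec) \<Rightarrow> bool" where
  "anderson n m M b x \<longleftrightarrow>
     x 0 \<in> carrier_vec n \<and>
     (\<forall>k. \<exists>\<beta>.
        is_min_norm_minimizer (min k m)
          (\<lambda>\<gamma>. (norm2 (residual M b (x k)
                   + diff_mat n (\<lambda>j. residual M b (x j)) k (min k m) *\<^sub>v \<gamma>))\<^sup>2) \<beta> \<and>
        x (k + 1) = fp_map M b (x k) + diff_mat n (\<lambda>j. fp_map M b (x j)) k (min k m) *\<^sub>v \<beta>)"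

end

theory Submission
  imports Defs
begin

text \<open>
  Write \<open>r\<^sub>j\<close> for the residual at \<open>x\<^sub>j\<close>, and let \<open>s = r\<^sub>k + R\<^sub>k \<beta>\<close> be the combination of residuals
  that the coefficients \<open>\<beta>\<close> of the step make as short as possible. Two facts give the theorem.

  First, \<open>r\<^sub>k\<^sub>+\<^sub>1 = M s\<close>, so that \<open>M\<^sup>-\<^sup>1 r\<^sub>k\<^sub>+\<^sub>1 = s\<close>
  (lemma \<open>residual_accelerated_step\<close>). Since \<open>I - M\<close> commutes with \<open>M\<close>, a plain
  fixed-point step multiplies the residual by \<open>M\<close>. The new iterate is the combination
  of the points \<open>q(x\<^sub>j)\<close> with the same coefficients that \<open>s\<close> has in terms of the \<open>r\<^sub>j\<close>, these
  coefficients add up to 1, and the residual is an affine function.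

  Second, a least-squares residual is orthogonal to the range of its matrix, so \<open>R\<^sub>k\<^sup>T s = 0\<close>
  (lemma \<open>least_squares_normal_equation\<close>).
\<close>

lemma norm2_square: "(norm2 v)\<^sup>2 = v \<bullet> v"
  by (simp add: norm2_def scalar_prod_def sum_nonneg)

lemma norm2_square_add:
  assumes "u \<in> carrier_vec n" and "v \<in> carrier_vec n"
  shows "(norm2 (u + v))\<^sup>2 = (norm2 u)\<^sup>2 + 2 * (u \<bullet> v) + (norm2 v)\<^sup>2"
  using assms unfolding norm2_square
  by (simp add: scalar_prod_add_distrib[of _ n] add_scalar_prod_distrib[of _ n]
      comm_scalar_prod[of v n u])

text \<open>
  A step from the minimizer \<open>\<beta>\<close> in the direction \<open>g = R\<^sup>T s\<close>, with \<open>s = u + R \<beta>\<close>, has slope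
  \<open>2 (g \<bullet> g)\<close>; as no step, forward or backward, can decrease the objective, \<open>g\<close> must vanish.
\<close>
lemma least_squares_normal_equation:
  assumes R: "R \<in> carrier_mat n p" and u: "u \<in> carrier_vec n"
    and min: "is_minimizer p (\<lambda>\<gamma>. (norm2 (u + R *\<^sub>v \<gamma>))\<^sup>2) \<beta>"
  shows "R\<^sup>T *\<^sub>v (u + R *\<^sub>v \<beta>) = 0\<^sub>v p"
proof -
  have \<beta>: "\<beta> \<in> carrier_vec p"
    and le: "\<And>\<gamma>. \<gamma> \<in> carrier_vec p \<Longrightarrow> (norm2 (u + R *\<^sub>v \<beta>))\<^sup>2 \<le> (norm2 (u + R *\<^sub>v \<gamma>))\<^sup>2"
    using min by (auto simp: is_minimizer_def)
  define s where "s = u + R *\<^sub>v \<beta>"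
  define g where "g = R\<^sup>T *\<^sub>v s"
  define a where "a = g \<bullet> g"
  define c where "c = (norm2 (R *\<^sub>v g))\<^sup>2"
  have s: "s \<in> carrier_vec n" unfolding s_def using R u \<beta> by simp
  have g: "g \<in> carrier_vec p" unfolding g_def using R s by simp
  have Rg: "R *\<^sub>v g \<in> carrier_vec n" using R g by simp
  have slope: "s \<bullet> (R *\<^sub>v g) = a"
    unfolding a_def using transpose_vec_mult_scalar[OF R g s] by (simp add: g_def)
  have quadratic: "0 \<le> 2 * t * a + t\<^sup>2 * c" for t
  proof -
    have "u + R *\<^sub>v (\<beta> + t \<cdot>\<^sub>v g) = s + t \<cdot>\<^sub>v (R *\<^sub>v g)"
      unfolding s_def using R u \<beta> g Rg
      by (simp add: mult_add_distrib_mat_vec[of _ n p] mult_mat_vec[of _ n p] assoc_add_vec[of _ n])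
    with le[of "\<beta> + t \<cdot>\<^sub>v g"] \<beta> g
    have "(norm2 s)\<^sup>2 \<le> (norm2 (s + t \<cdot>\<^sub>v (R *\<^sub>v g)))\<^sup>2" by (simp add: s_def)
    also have "\<dots> = (norm2 s)\<^sup>2 + 2 * t * a + t\<^sup>2 * c"
      using s Rg slope
      by (simp add: norm2_square_add[of _ n]) (simp add: c_def norm2_square, simp add: power2_eq_square)
    finally show ?thesis by simp
  qed
  have c0: "0 \<le> c" by (simp add: c_def)
  have "a = 0"
  proof (rule ccontr)
    assume "a \<noteq> 0"
    \<comment> \<open>Adding 1 to \<open>c\<close> keeps the step length of the exact line search finite when \<open>R g = 0\<close>.\<close>
    define t where "t = - a / (c + 1)"
    have ac: "a = - t * (c + 1)" using c0 by (simp add: t_def)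
    with \<open>a \<noteq> 0\<close> have "0 < t\<^sup>2" by auto
    have "2 * t * a + t\<^sup>2 * c = - (t\<^sup>2 * (c + 2))"
      by (simp add: ac power2_eq_square algebra_simps)
    moreover have "0 < t\<^sup>2 * (c + 2)" using \<open>0 < t\<^sup>2\<close> c0 by simp
    ultimately show False using quadratic[of t] by simp
  qed
  then have "g = 0\<^sub>v p"
    using g by (intro eq_vecI) (auto simp: a_def scalar_prod_def sum_nonneg_eq_0_iff)
  then show ?thesis by (simp add: g_def s_def)
qed

lemma diff_mat_carrier: "diff_mat n v k p \<in> carrier_mat n p"
  by (rule carrier_matI) (simp_all add: diff_mat_def del: upt_Suc)

lemma mult_diff_mat:
  assumes F: "F \<in> carrier_mat n n" and v: "\<And>j. v j \<in> carrier_vec n"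
  shows "F * diff_mat n v k p = diff_mat n (\<lambda>j. F *\<^sub>v v j) k p"
proof (rule mat_col_eqI)
  fix i assume "i < dim_col (diff_mat n (\<lambda>j. F *\<^sub>v v j) k p)"
  then have i: "i < p" by (simp add: diff_mat_def del: upt_Suc)
  have col: "col (diff_mat n w k p) i = w k - w (k - Suc i)" if "\<And>j. w j \<in> carrier_vec n" for w
    using i that by (simp add: diff_mat_def col_mat_of_cols del: upt_Suc)
  have "col (F * diff_mat n v k p) i = F *\<^sub>v (v k - v (k - Suc i))"
    using i F col[of v] v by (simp add: col_mult2[OF F diff_mat_carrier])
  then show "col (F * diff_mat n v k p) i = col (diff_mat n (\<lambda>j. F *\<^sub>v v j) k p) i"
    using F v col[of "\<lambda>j. F *\<^sub>v v j"] by (simp add: mult_minus_distrib_mat_vec[of _ n n])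
qed (use F in \<open>auto simp: diff_mat_def simp del: upt_Suc\<close>)

lemma diff_mat_translate:
  assumes v: "\<And>j. v j \<in> carrier_vec n" and c: "c \<in> carrier_vec n"
  shows "diff_mat n (\<lambda>j. v j - c) k p = diff_mat n v k p"
proof -
  have "(v i - c) - (v j - c) = v i - v j" for i j
    using v[of i] v[of j] c by (intro eq_vecI) auto
  then show ?thesis by (simp add: diff_mat_def)
qed

lemma residual_affine:
  assumes "M \<in> carrier_mat n n" and "b \<in> carrier_vec n" and "y \<in> carrier_vec n"
  shows "residual M b y = (1\<^sub>m n - M) *\<^sub>v y - b"
  using assms unfolding residual_def fp_map_def
  by (simp add: minus_mult_distrib_mat_vec[of _ n n]) (intro eq_vecI, auto)

lemma residual_fp_map:
  assumes "M \<in> carrier_mat n n" and "b \<in> carrier_vec n" and "y \<in> carrier_vec n"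
  shows "residual M b (fp_map M b y) = M *\<^sub>v residual M b y"
proof -
  have "M *\<^sub>v y \<in> carrier_vec n" "M *\<^sub>v (M *\<^sub>v y + b) \<in> carrier_vec n" using assms by auto
  with assms show ?thesis unfolding residual_def fp_map_def
    by (subst mult_minus_distrib_mat_vec[of _ n n]) (auto intro!: eq_vecI)
qed

text \<open>
  The columns of the difference matrix of the points \<open>q(x\<^sub>j)\<close> are differences, so the linear part
  \<open>I - M\<close> of the residual maps them to differences of the residuals \<open>M r\<^sub>j\<close> of those points.
\<close>
lemma residual_accelerated_step:
  assumes M: "M \<in> carrier_mat n n" and b: "b \<in> carrier_vec n"
    and x: "\<And>j. x j \<in> carrier_vec n" and \<beta>: "\<beta> \<in> carrier_vec p"
  shows "residual M b (fp_map M b (x k) + diff_mat n (\<lambda>j. fp_map M b (x j)) k p *\<^sub>v \<beta>)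
    = M *\<^sub>v (residual M b (x k) + diff_mat n (\<lambda>j. residual M b (x j)) k p *\<^sub>v \<beta>)"
proof -
  define q where "q = (\<lambda>j. fp_map M b (x j))"
  define r where "r = (\<lambda>j. residual M b (x j))"
  define A where "A = 1\<^sub>m n - M"
  define Q where "Q = diff_mat n q k p"
  define R where "R = diff_mat n r k p"
  have q: "q j \<in> carrier_vec n" for j using M b x by (simp add: q_def fp_map_def)
  have r: "r j \<in> carrier_vec n" for j using x[of j] q[of j] by (simp add: r_def q_def residual_def)
  have A: "A \<in> carrier_mat n n" using M by (simp add: A_def minus_carrier_mat)
  have Q: "Q \<in> carrier_mat n p" and R: "R \<in> carrier_mat n p"
    by (simp_all add: Q_def R_def diff_mat_carrier)
  have resq: "A *\<^sub>v q j - b = M *\<^sub>v r j" for j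
    using residual_affine[OF M b q[of j]] residual_fp_map[OF M b x[of j]]
    by (simp add: A_def q_def r_def)
  have "A * Q = diff_mat n (\<lambda>j. A *\<^sub>v q j) k p"
    unfolding Q_def by (rule mult_diff_mat[OF A q])
  also have "\<dots> = diff_mat n (\<lambda>j. A *\<^sub>v q j - b) k p"
    by (rule diff_mat_translate[symmetric]) (use A q b in auto)
  also have "\<dots> = M * R"
    unfolding resq R_def by (rule mult_diff_mat[OF M r, symmetric])
  finally have AQ: "A * Q = M * R" .
  have Q\<beta>: "Q *\<^sub>v \<beta> \<in> carrier_vec n" and R\<beta>: "R *\<^sub>v \<beta> \<in> carrier_vec n" using Q R \<beta> by auto
  have "residual M b (q k + Q *\<^sub>v \<beta>) = A *\<^sub>v (q k + Q *\<^sub>v \<beta>) - b"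
    unfolding A_def by (rule residual_affine[OF M b]) (use q Q\<beta> in simp)
  also have "\<dots> = (A *\<^sub>v q k - b) + A *\<^sub>v (Q *\<^sub>v \<beta>)"
    unfolding mult_add_distrib_mat_vec[OF A q Q\<beta>] using A b by (intro eq_vecI) auto
  also have "\<dots> = M *\<^sub>v r k + M *\<^sub>v (R *\<^sub>v \<beta>)"
    unfolding resq by (simp add: AQ flip: assoc_mult_mat_vec[OF A Q \<beta>] assoc_mult_mat_vec[OF M R \<beta>])
  also have "\<dots> = M *\<^sub>v (r k + R *\<^sub>v \<beta>)"
    by (rule mult_add_distrib_mat_vec[OF M r R\<beta>, symmetric])
  finally show ?thesis by (simp add: q_def r_def Q_def R_def)
qed

lemma anderson_carrier:
  assumes M: "M \<in> carrier_mat n n" and b: "b \<in> carrier_vec n" and "anderson n m M b x"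
  shows "x k \<in> carrier_vec n"
proof (cases k)
  case 0
  then show ?thesis using assms(3) by (simp add: anderson_def)
next
  case (Suc l)
  then obtain \<beta> where \<beta>: "\<beta> \<in> carrier_vec (min l m)"
    and step: "x k = fp_map M b (x l) + diff_mat n (\<lambda>j. fp_map M b (x j)) l (min l m) *\<^sub>v \<beta>"
    using assms(3) unfolding anderson_def is_min_norm_minimizer_def is_minimizer_def
    by (metis Suc_eq_plus1)
  have "diff_mat n (\<lambda>j. fp_map M b (x j)) l (min l m) *\<^sub>v \<beta> \<in> carrier_vec n"
    using mult_mat_vec_carrier[OF diff_mat_carrier \<beta>] .
  moreover have "fp_map M b (x l) \<in> carrier_vec n"
    using M b by (auto simp: fp_map_def intro!: carrier_vecI)
  ultimately show ?thesis unfolding step by simp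
qed

lemma mat_inverse_mult_vec_cancel:
  fixes M :: "'a :: field mat"
  assumes M: "M \<in> carrier_mat n n" and inv: "invertible_mat M" and v: "v \<in> carrier_vec n"
  shows "the (mat_inverse M) *\<^sub>v (M *\<^sub>v v) = v"
proof (cases "mat_inverse M")
  case None
  from inv obtain B where B: "M * B = 1\<^sub>m n" "B * M = 1\<^sub>m (dim_row B)"
    using M by (auto simp: invertible_mat_def inverts_mat_def)
  have "dim_col B = n" "dim_row B = n"
    using arg_cong[OF B(1), of dim_col] arg_cong[OF B(2), of dim_col] M by auto
  then have "B \<in> carrier_mat n n" by auto
  with B M have "M \<in> Units (ring_mat TYPE('a) n ())"
    unfolding Units_def by (auto simp: ring_mat_simps)
  with mat_inverse(1)[OF M None, of "()"] show ?thesis by simp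
next
  case (Some B)
  from mat_inverse(2)[OF M Some] have "B * M = 1\<^sub>m n" "B \<in> carrier_mat n n" by auto
  with Some M v show ?thesis by (simp flip: assoc_mult_mat_vec)
qed

theorem proposition2p6:
  fixes n m k :: nat
    and M :: "real mat"
    and b :: "real vec"
    and x :: "nat \<Rightarrow> real vec"
  assumes "M \<in> carrier_mat n n" and "b \<in> carrier_vec n"
    and "invertible_mat (1\<^sub>m n - M)" and "M \<noteq> 0\<^sub>m n n"
    and "m \<ge> 1"
    and "anderson n m M b x"
    and "invertible_mat M"
    and "k \<ge> m"
  shows "(diff_mat n (\<lambda>j. residual M b (x j)) k m)\<^sup>T
           *\<^sub>v (the (mat_inverse M) *\<^sub>v residual M b (x (k + 1))) = 0\<^sub>v m"
proof -
  note M = assms(1) and b = assms(2)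
  have x: "x j \<in> carrier_vec n" for j by (rule anderson_carrier[OF M b assms(6)])
  define R where "R = diff_mat n (\<lambda>j. residual M b (x j)) k m"
  define u where "u = residual M b (x k)"
  have R: "R \<in> carrier_mat n m" by (simp add: R_def diff_mat_carrier)
  have u: "u \<in> carrier_vec n" using M b x by (simp add: u_def residual_def fp_map_def)
  have "min k m = m" using assms(8) by simp
  then obtain \<beta> where min: "is_minimizer m (\<lambda>\<gamma>. (norm2 (u + R *\<^sub>v \<gamma>))\<^sup>2) \<beta>"
    and step: "x (k + 1) = fp_map M b (x k) + diff_mat n (\<lambda>j. fp_map M b (x j)) k m *\<^sub>v \<beta>"
    using assms(6) unfolding anderson_def is_min_norm_minimizer_def u_def R_def by metis
  have \<beta>: "\<beta> \<in> carrier_vec m" using min by (simp add: is_minimizer_def)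
  have "residual M b (x (k + 1)) = M *\<^sub>v (u + R *\<^sub>v \<beta>)"
    unfolding step u_def R_def by (rule residual_accelerated_step[OF M b x \<beta>])
  moreover have "u + R *\<^sub>v \<beta> \<in> carrier_vec n" using u R \<beta> by simp
  ultimately have "the (mat_inverse M) *\<^sub>v residual M b (x (k + 1)) = u + R *\<^sub>v \<beta>"
    using mat_inverse_mult_vec_cancel[OF M assms(7)] by simp
  with least_squares_normal_equation[OF R u min] show ?thesis by (simp add: R_def)
qed

end
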